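(* Let $|||\cdot|||$ be a normalized symmetric gauge norm on $c_{00}=\mathcal{J}(l^\infty(\mathbb{N}))$. Then there is a subset $\mathcal{G}'$ of $\mathcal{G}$ with $(1,0,0,\dots)\in\mathcal{G}'$ such that for all $(x_1,x_2,\dots)\in c_{00}$, $$|||(x_1,x_2,\dots)|||=\sup\{a_1x_1^*+a_2x_2^*+\cdots:\ (a_1,a_2,\dots)\in\mathcal{G}'\},$$ where $(x_1^*,x_2^*,\dots)$ is the nonincreasing rearrangement of $(|x_1|,|x_2|,\dots)$.
   Context: $c_{00}$ is the space of complex sequences with only finitely many non-zero terms. A norm on $c_{00}$ is a symmetric gauge norm if $|||(x_1,x_2,\dots)|||=|||(|x_1|,|x_2|,\dots)|||$ and $|||(x_1,x_2,\dots)|||=|||(x_{\pi(1)},x_{\pi(2)},\dots)|||$ for every permutation $\pi$ of $\mathbb{N}$; it is normalized if $|||(1,0,0,\dots)|||=1$. $\mathcal{G}=\{(a_1,a_2,\dots):\ 1\ge a_1\ge a_2\ge\cdots\ge0,\ a_n=0\text{ except for finitely many } n\}$. *)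

theory Defs
  imports "HOL-Analysis.Analysis"
begin

text \<open>
  Sequences are indexed from \<open>0\<close>, so \<open>x\<^sub>1, x\<^sub>2, \<dots>\<close> is rendered as \<open>x 0, x 1, \<dots>\<close>.
\<close>

definition c00 :: "(nat \<Rightarrow> complex) set"
  where "c00 = {x. finite {n. x n \<noteq> 0}}"

text \<open>
  A norm on the complex vector space \<^const>\<open>c00\<close> is a function on all sequences of which only
  the values on \<^const>\<open>c00\<close> matter.
\<close>

definition norm_on_c00 :: "((nat \<Rightarrow> complex) \<Rightarrow> real) \<Rightarrow> bool"
  where "norm_on_c00 N \<longleftrightarrow>
    (\<forall>x\<in>c00. 0 \<le> N x \<and> (N x = 0 \<longleftrightarrow> x = (\<lambda>n. 0))) \<and>
    (\<forall>c. \<forall>x\<in>c00. N (\<lambda>n. c * x n) = cmod c * N x) \<and>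
    (\<forall>x\<in>c00. \<forall>y\<in>c00. N (\<lambda>n. x n + y n) \<le> N x + N y)"

definition symmetric_gauge_norm :: "((nat \<Rightarrow> complex) \<Rightarrow> real) \<Rightarrow> bool"
  where "symmetric_gauge_norm N \<longleftrightarrow>
    norm_on_c00 N \<and>
    (\<forall>x\<in>c00. N x = N (\<lambda>n. complex_of_real (cmod (x n)))) \<and>
    (\<forall>x\<in>c00. \<forall>\<pi>. bij \<pi> \<longrightarrow> N x = N (\<lambda>n. x (\<pi> n)))"

definition normalized_norm :: "((nat \<Rightarrow> complex) \<Rightarrow> real) \<Rightarrow> bool"
  where "normalized_norm N \<longleftrightarrow> N (\<lambda>n. if n = 0 then 1 else 0) = 1"

definition gauge_coeffs :: "(nat \<Rightarrow> real) set"
  where "gauge_coeffs =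
    {a. a 0 \<le> 1 \<and> decseq a \<and> (\<forall>n. 0 \<le> a n) \<and> finite {n. a n \<noteq> 0}}"

text \<open>
  For \<open>x\<close> in \<^const>\<open>c00\<close> the description below determines exactly one sequence, see
  \<open>decreasing_rearrangement_ex1\<close>.
\<close>

definition decreasing_rearrangement :: "(nat \<Rightarrow> complex) \<Rightarrow> nat \<Rightarrow> real"
  where "decreasing_rearrangement x =
    (THE y. decseq y \<and> (\<exists>\<pi>. bij \<pi> \<and> y = (\<lambda>n. cmod (x (\<pi> n)))))"

lemma decseq_equidistributed_le:
  fixes y z :: "nat \<Rightarrow> real"
  assumes "decseq z" "decseq y" "bij \<sigma>" "\<And>n. z n = y (\<sigma> n)"
    and fin: "finite {n. z n \<noteq> 0}" and nonneg: "\<And>n. 0 \<le> y n"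
  shows "z n \<le> y n"
proof (rule ccontr)
  assume "\<not> z n \<le> y n"
  then have less: "y n < z n" by simp
  have finz: "finite {m. y n < z m}"
    by (rule finite_subset[OF _ fin]) (use nonneg[of n] in auto)
  have eq: "{m. y n < y m} = \<sigma> ` {m. y n < z m}"
  proof -
    have "m \<in> \<sigma> ` {m. y n < z m}" if "y n < y m" for m
    proof -
      obtain k where "m = \<sigma> k" using \<open>bij \<sigma>\<close> by (meson bij_pointE)
      then show ?thesis using that assms(4) by auto
    qed
    then show ?thesis using assms(4) by auto
  qed
  have "card {m. y n < y m} = card {m. y n < z m}"
    unfolding eq using \<open>bij \<sigma>\<close> by (intro card_image) (meson bij_is_inj inj_on_subset subset_UNIV)
  moreover have "{..n} \<subseteq> {m. y n < z m}"
    using less \<open>decseq z\<close> by (auto simp: decseq_def intro: less_le_trans)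
  then have "card {..n} \<le> card {m. y n < z m}"
    using finz by (rule card_mono[rotated])
  moreover have "{m. y n < y m} \<subseteq> {..<n}"
    using \<open>decseq y\<close> by (auto simp: decseq_def) (meson leD not_less)
  then have "card {m. y n < y m} \<le> card {..<n}"
    by (rule card_mono[rotated]) simp
  ultimately show False by simp
qed

lemma decreasing_rearrangement_exists:
  assumes "x \<in> c00"
  shows "\<exists>\<pi>. bij \<pi> \<and> decseq (\<lambda>n. cmod (x (\<pi> n)))"
proof -
  define S where "S = {n. x n \<noteq> 0}"
  have fin: "finite S" using assms by (simp add: S_def c00_def)
  define l where "l = sort_key (\<lambda>i. - cmod (x i)) (sorted_list_of_set S)"
  define k where "k = card S"
  have l: "set l = S" "distinct l" "length l = k"
    using fin by (simp_all add: l_def k_def)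
  have srt: "sorted (map (\<lambda>i. - cmod (x i)) l)" by (simp add: l_def)
  define \<pi> where "\<pi> i = (if i < k then l ! i else enumerate (- S) (i - k))" for i
  have inf: "infinite (- S)" using fin by (simp add: Compl_eq_Diff_UNIV Diff_infinite_finite)
  have "bij_betw ((!) l) {..<k} S" using l by (intro bij_betw_nth) auto
  then have b1: "bij_betw \<pi> {..<k} S"
    by (rule bij_betw_cong[THEN iffD1, rotated]) (simp add: \<pi>_def)
  have "bij_betw (\<lambda>i. i - k) {k..} UNIV"
    by (rule bij_betw_byWitness[where f' = "\<lambda>i. i + k"]) auto
  then have "bij_betw (enumerate (- S) \<circ> (\<lambda>i. i - k)) {k..} (- S)"
    by (rule bij_betw_trans) (rule bij_enumerate[OF inf])
  then have b2: "bij_betw \<pi> {k..} (- S)"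
    by (rule bij_betw_cong[THEN iffD1, rotated]) (simp add: \<pi>_def)
  have "bij_betw \<pi> ({..<k} \<union> {k..}) (S \<union> - S)"
    using b1 b2 by (rule bij_betw_combine) auto
  moreover have "{..<k} \<union> {k..} = (UNIV :: nat set)" by auto
  ultimately have bij: "bij \<pi>" by simp
  have "cmod (x (\<pi> j)) \<le> cmod (x (\<pi> i))" if "i \<le> j" for i j
  proof (cases "j < k")
    case True
    then show ?thesis
      using that sorted_nth_mono[OF srt that] l by (simp add: \<pi>_def)
  next
    case False
    then have "\<pi> j \<in> - S" using bij_betwE[OF b2] by simp
    then show ?thesis by (simp add: S_def)
  qed
  with bij show ?thesis by (auto simp: decseq_def)
qed

lemma decreasing_rearrangement_ex1:
  assumes "x \<in> c00"
  shows "\<exists>!y. decseq y \<and> (\<exists>\<pi>. bij \<pi> \<and> y = (\<lambda>n. cmod (x (\<pi> n))))"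
proof -
  have le: "cmod (x (\<pi> n)) \<le> cmod (x (\<rho> n))"
    if "bij \<pi>" "bij \<rho>" "decseq (\<lambda>n. cmod (x (\<pi> n)))" "decseq (\<lambda>n. cmod (x (\<rho> n)))" for \<pi> \<rho> n
  proof (rule decseq_equidistributed_le[OF that(3,4)])
    show "bij (inv \<rho> \<circ> \<pi>)" using that by (simp add: bij_comp bij_imp_bij_inv)
    show "cmod (x (\<pi> m)) = cmod (x (\<rho> ((inv \<rho> \<circ> \<pi>) m)))" for m
      using that by (simp add: bij_is_surj surj_f_inv_f)
    have "finite (\<pi> -` {n. x n \<noteq> 0})"
      using assms that by (intro finite_vimageI) (auto simp: c00_def bij_is_inj)
    then show "finite {n. cmod (x (\<pi> n)) \<noteq> 0}" by (simp add: vimage_def)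
  qed simp
  obtain \<pi> where \<pi>: "bij \<pi>" "decseq (\<lambda>n. cmod (x (\<pi> n)))"
    using decreasing_rearrangement_exists[OF assms] by blast
  show ?thesis
  proof (rule ex1I)
    show "decseq (\<lambda>n. cmod (x (\<pi> n))) \<and>
        (\<exists>\<rho>. bij \<rho> \<and> (\<lambda>n. cmod (x (\<pi> n))) = (\<lambda>n. cmod (x (\<rho> n))))"
      using \<pi> by blast
  next
    fix y assume "decseq y \<and> (\<exists>\<rho>. bij \<rho> \<and> y = (\<lambda>n. cmod (x (\<rho> n))))"
    then obtain \<rho> where \<rho>: "bij \<rho>" "decseq y" "y = (\<lambda>n. cmod (x (\<rho> n)))" by blast
    have "decseq (\<lambda>n. cmod (x (\<rho> n)))" using \<rho>(2) unfolding \<rho>(3) .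
    with \<pi> \<rho>(1) show "y = (\<lambda>n. cmod (x (\<pi> n)))"
      unfolding \<rho>(3) by (intro ext antisym le)
  qed
qed

end

theory Submission
  imports Defs
begin

text \<open>
  Take for \<open>G'\<close> the largest conceivable set, the polar: all \<open>a\<close> with
  \<open>\<Sum> a\<^sub>n x\<^sub>n\<^sup>* \<le> N x\<close> for every \<open>x\<close>. The supremum is then attained. Indeed, a Hahn-Banach functional
  on finitely many coordinates that norms \<open>x\<^sup>*\<close> has coefficients \<open>f\<close>, and the nonincreasing
  rearrangement of \<open>\<bar>f\<bar>\<close> lies in the polar by the symmetries of \<open>N\<close>, while the rearrangement
  inequality shows that it still norms \<open>x\<^sup>*\<close>.
\<close>

section \<open>Sublinear functionals and a finite-dimensional Hahn-Banach theorem\<close>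

definition sublinear :: "(('i \<Rightarrow> real) \<Rightarrow> real) \<Rightarrow> bool"
  where "sublinear p \<longleftrightarrow>
    (\<forall>x y. p (\<lambda>i. x i + y i) \<le> p x + p y) \<and>
    (\<forall>c\<ge>0. \<forall>x. p (\<lambda>i. c * x i) \<le> c * p x)"

lemma sublinear_add: "sublinear p \<Longrightarrow> p (\<lambda>i. x i + y i) \<le> p x + p y"
  and sublinear_scale: "sublinear p \<Longrightarrow> 0 \<le> c \<Longrightarrow> p (\<lambda>i. c * x i) \<le> c * p x"
  by (auto simp: sublinear_def)

lemma sublinear_zero:
  assumes "sublinear p"
  shows "p (\<lambda>i. 0) = 0"
  using sublinear_add[OF assms, of "\<lambda>i. 0" "\<lambda>i. 0"] sublinear_scale[OF assms, of 0 "\<lambda>i. 0"]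
  by simp

lemma sublinear_neg:
  assumes "sublinear p"
  shows "- p x \<le> p (\<lambda>i. - x i)"
  using sublinear_add[OF assms, of x "\<lambda>i. - x i"] sublinear_zero[OF assms] by simp

lemma sublinear_sum:
  assumes "sublinear p" "finite I"
  shows "p (\<lambda>i. \<Sum>j\<in>I. g j i) \<le> (\<Sum>j\<in>I. p (g j))"
  using assms(2)
proof (induction I rule: finite_induct)
  case empty
  then show ?case using sublinear_zero[OF assms(1)] by simp
next
  case (insert j I)
  then show ?case
    using sublinear_add[OF assms(1), of "g j" "\<lambda>i. \<Sum>j\<in>I. g j i"] by simp
qed

text \<open>The witness is \<open>q y = Inf {p (y + t v) - t p v | t \<ge> 0}\<close>, the classical
  way to lower a sublinear functional. At \<open>y = - v\<close> the choice \<open>t = 1\<close>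
  gives \<open>q (- v) \<le> - p v\<close>; since also \<open>- q v \<le> q (- v)\<close> and
  \<open>q v \<le> p v\<close>, this forces \<open>q v = p v\<close> and makes \<open>q\<close>
  linear on the line through \<open>v\<close>.\<close>

lemma sublinear_linear_along:
  assumes p: "sublinear p"
  obtains q where "sublinear q" "\<And>x. q x \<le> p x" "q (\<lambda>i. - v i) \<le> - p v"
proof
  define A where "A y = {p (\<lambda>i. y i + t * v i) - t * p v | t. 0 \<le> t}" for y
  define q where "q y = Inf (A y)" for y
  \<comment> \<open>The infimum is finite, because
    \<open>t p v \<le> p (t v) \<le> p (y + t v) + p (- y)\<close>.\<close>
  have lower: "- p (\<lambda>i. - y i) \<le> a" if "a \<in> A y" for a y
  proof -
    obtain t where t: "0 \<le> t" "a = p (\<lambda>i. y i + t * v i) - t * p v"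
      using \<open>a \<in> A y\<close> by (auto simp: A_def)
    \<comment> \<open>Sublinearity supplies homogeneity only as an upper bound; the reverse bound
      for \<open>t > 0\<close> comes from scaling by \<open>1 / t\<close>.\<close>
    have "t * p v \<le> p (\<lambda>i. t * v i)"
    proof (cases "t = 0")
      case False
      then show ?thesis
        using sublinear_scale[OF p, of "1 / t" "\<lambda>i. t * v i"] t(1) by (simp add: field_simps)
    qed (simp add: sublinear_zero[OF p])
    then show ?thesis
      using sublinear_add[OF p, of "\<lambda>i. y i + t * v i" "\<lambda>i. - y i"] t(2) by simp
  qed
  have bdd: "bdd_below (A y)" for y
    using lower by (rule bdd_belowI)
  have q_le: "q y \<le> p (\<lambda>i. y i + t * v i) - t * p v" if "0 \<le> t" for y t
    unfolding q_def by (rule cInf_lower[OF _ bdd]) (use that in \<open>auto simp: A_def\<close>)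
  have le_q: "b \<le> q y" if "\<And>t. 0 \<le> t \<Longrightarrow> b \<le> p (\<lambda>i. y i + t * v i) - t * p v" for b y
    unfolding q_def
  proof (rule cInf_greatest)
    show "A y \<noteq> {}" unfolding A_def by auto
  qed (use that in \<open>auto simp: A_def\<close>)
  show q_le_p: "q y \<le> p y" for y
    using q_le[of 0 y] by simp
  show "q (\<lambda>i. - v i) \<le> - p v"
    using q_le[of 1 "\<lambda>i. - v i"] sublinear_zero[OF p] by simp
  show "sublinear q"
    unfolding sublinear_def
  proof (intro conjI allI impI)
    fix x y
    \<comment> \<open>Parameters \<open>s\<close> for \<open>x\<close> and \<open>t\<close> for
      \<open>y\<close> combine to \<open>s + t\<close> for the sum. The infimum is then taken over
      \<open>s\<close> first and over \<open>t\<close> afterwards.\<close>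
    have "q (\<lambda>i. x i + y i) - (p (\<lambda>i. y i + t * v i) - t * p v)
        \<le> p (\<lambda>i. x i + s * v i) - s * p v" if "0 \<le> s" "0 \<le> t" for s t
      using q_le[of "s + t" "\<lambda>i. x i + y i"] that
        sublinear_add[OF p, of "\<lambda>i. x i + s * v i" "\<lambda>i. y i + t * v i"]
      by (simp add: algebra_simps)
    then have "q (\<lambda>i. x i + y i) - q x \<le> p (\<lambda>i. y i + t * v i) - t * p v" if "0 \<le> t" for t
      using le_q[of "q (\<lambda>i. x i + y i) - (p (\<lambda>i. y i + t * v i) - t * p v)" x] that by force
    then show "q (\<lambda>i. x i + y i) \<le> q x + q y"
      using le_q[of "q (\<lambda>i. x i + y i) - q x" y] by force
  next
    fix c :: real and x
    assume "0 \<le> c"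
    show "q (\<lambda>i. c * x i) \<le> c * q x"
    proof (cases "c = 0")
      case True
      then show ?thesis
        using q_le_p[of "\<lambda>i. 0"] sublinear_zero[OF p] by simp
    next
      case False
      with \<open>0 \<le> c\<close> have "0 < c" by simp
      \<comment> \<open>The parameter \<open>t\<close> for \<open>x\<close> corresponds to
        \<open>c * t\<close> for \<open>c x\<close>.\<close>
      have "q (\<lambda>i. c * x i) / c \<le> p (\<lambda>i. x i + t * v i) - t * p v" if "0 \<le> t" for t
      proof -
        have "q (\<lambda>i. c * x i) \<le> p (\<lambda>i. c * (x i + t * v i)) - c * t * p v"
          using q_le[of "c * t" "\<lambda>i. c * x i"] that \<open>0 < c\<close> by (simp add: algebra_simps)
        also have "\<dots> \<le> c * (p (\<lambda>i. x i + t * v i) - t * p v)"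
          using sublinear_scale[OF p \<open>0 \<le> c\<close>, of "\<lambda>i. x i + t * v i"] by (simp add: algebra_simps)
        finally show ?thesis using \<open>0 < c\<close> by (simp add: field_simps)
      qed
      then have "q (\<lambda>i. c * x i) / c \<le> q x" by (rule le_q)
      then show ?thesis using \<open>0 < c\<close> by (simp add: field_simps)
    qed
  qed
qed

text \<open>Lowering along one vector after another works because linearity already gained survives:
  if \<open>r \<le> q\<close>, then
  \<open>r (- w) \<le> q (- w) \<le> - q w \<le> - r w\<close>.\<close>

lemma sublinear_linear_along_finite:
  assumes "finite V" "sublinear p"
  shows "\<exists>q. sublinear q \<and> (\<forall>x. q x \<le> p x) \<and> (\<forall>v\<in>V. q (\<lambda>i. - v i) \<le> - q v)"
  using assms(1)
proof (induction V rule: finite_induct)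
  case empty
  then show ?case using assms(2) by blast
next
  case (insert v V)
  then obtain q where q: "sublinear q" "\<And>x. q x \<le> p x" "\<And>w. w \<in> V \<Longrightarrow> q (\<lambda>i. - w i) \<le> - q w"
    by blast
  obtain r where r: "sublinear r" "\<And>x. r x \<le> q x" "r (\<lambda>i. - v i) \<le> - q v"
    using sublinear_linear_along[OF q(1)] by blast
  have "r (\<lambda>i. - w i) \<le> - r w" if "w \<in> insert v V" for w
  proof (cases "w = v")
    case True
    then show ?thesis using r(2)[of v] r(3) by simp
  next
    case False
    then show ?thesis using q(3)[of w] r(2)[of w] r(2)[of "\<lambda>i. - w i"] that by simp
  qed
  moreover have "r x \<le> p x" for x using r(2)[of x] q(2)[of x] by simp
  ultimately show ?case using r(1) by blast
qed

text \<open>A first lowering along \<open>x\<close> secures the value \<open>p x\<close> there. A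
  second one, along the unit vectors \<open>e j\<close>, gives a \<open>q\<close> that is linear on
  vectors supported in \<open>I\<close>, and its values \<open>q (e i)\<close> are the coefficients
  \<open>f i\<close>.\<close>

lemma finite_dim_Hahn_Banach:
  fixes p :: "('i \<Rightarrow> real) \<Rightarrow> real"
  assumes p: "sublinear p" and I: "finite I" and x: "\<And>i. i \<notin> I \<Longrightarrow> x i = 0"
  shows "\<exists>f. (\<forall>i. i \<notin> I \<longrightarrow> f i = 0) \<and>
    (\<forall>y. (\<forall>i. i \<notin> I \<longrightarrow> y i = 0) \<longrightarrow> (\<Sum>i\<in>I. f i * y i) \<le> p y) \<and>
    p x \<le> (\<Sum>i\<in>I. f i * x i)"
proof -
  define e where "e j = (\<lambda>i. if i = j then 1 else 0 :: real)" for j :: 'i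
  obtain r where r: "sublinear r" "\<And>y. r y \<le> p y" "r (\<lambda>i. - x i) \<le> - p x"
    using sublinear_linear_along[OF p] by blast
  obtain q where q: "sublinear q" "\<And>y. q y \<le> r y" "\<And>j. j \<in> I \<Longrightarrow> q (\<lambda>i. - e j i) \<le> - q (e j)"
    using sublinear_linear_along_finite[OF finite_imageI[OF I] r(1), of e] by blast
  have le: "q y \<le> (\<Sum>j\<in>I. q (e j) * y j)" if y: "\<And>i. i \<notin> I \<Longrightarrow> y i = 0" for y
  proof -
    \<comment> \<open>For negative \<open>y j\<close> the vector is read as \<open>- y j\<close>
      times \<open>- e j\<close>, so that sublinearity meets a nonnegative scalar and linearity
      along \<open>e j\<close> does the rest.\<close>
    have "q (\<lambda>i. y j * e j i) \<le> q (e j) * y j" if "j \<in> I" for j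
    proof (cases "0 \<le> y j")
      case True
      then show ?thesis using sublinear_scale[OF q(1) True, of "e j"] by (simp add: mult.commute)
    next
      case False
      then have "q (\<lambda>i. - y j * - e j i) \<le> - y j * q (\<lambda>i. - e j i)"
        by (intro sublinear_scale[OF q(1)]) simp
      also have "\<dots> \<le> - y j * - q (e j)"
        using False q(3)[OF that] by (intro mult_left_mono) auto
      finally show ?thesis by (simp add: mult.commute)
    qed
    then have "(\<Sum>j\<in>I. q (\<lambda>i. y j * e j i)) \<le> (\<Sum>j\<in>I. q (e j) * y j)"
      by (rule sum_mono)
    moreover have "(\<lambda>i. \<Sum>j\<in>I. y j * e j i) = y"
    proof
      fix i
      have "(\<Sum>j\<in>I. y j * e j i) = (\<Sum>j\<in>I. if i = j then y j else 0)"
        by (rule sum.cong) (auto simp: e_def)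
      then show "(\<Sum>j\<in>I. y j * e j i) = y i" using I y[of i] by simp
    qed
    ultimately show ?thesis
      using sublinear_sum[OF q(1) I, of "\<lambda>j i. y j * e j i"] by simp
  qed
  show ?thesis
  proof (intro exI[of _ "\<lambda>i. if i \<in> I then q (e i) else 0"] conjI allI impI)
    fix y :: "'i \<Rightarrow> real"
    assume "\<forall>i. i \<notin> I \<longrightarrow> y i = 0"
    \<comment> \<open>The estimate \<open>le\<close> at \<open>- y\<close> bounds the sum above by
      \<open>- q (- y)\<close>, and \<open>- q (- y) \<le> q y \<le> r y \<le> p y\<close>.\<close>
    then have "q (\<lambda>i. - y i) \<le> - (\<Sum>j\<in>I. q (e j) * y j)"
      using le[of "\<lambda>i. - y i"] by (simp add: sum_negf)
    then have "(\<Sum>i\<in>I. q (e i) * y i) \<le> p y"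
      using sublinear_neg[OF q(1), of "\<lambda>i. - y i"] q(2)[of y] r(2)[of y] by simp
    then show "(\<Sum>i\<in>I. (if i \<in> I then q (e i) else 0) * y i) \<le> p y" by simp
  next
    \<comment> \<open>The value at \<open>x\<close> survives the second lowering:
      \<open>p x \<le> - r (- x) \<le> - q (- x) \<le> q x\<close>.\<close>
    have "p x \<le> q x"
      using sublinear_neg[OF q(1), of x] q(2)[of "\<lambda>i. - x i"] r(3) by simp
    then show "p x \<le> (\<Sum>i\<in>I. (if i \<in> I then q (e i) else 0) * x i)"
      using le[of x] x by simp
  qed simp
qed

section \<open>The rearrangement inequality\<close>

text \<open>Induction splits off the largest index \<open>b\<close>. All other indices lie below it,
  so \<open>card A \<le> b\<close> and \<open>a b \<le> a (card A)\<close>.\<close>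

lemma sum_decseq_le:
  fixes a :: "nat \<Rightarrow> real"
  assumes "decseq a" "finite A"
  shows "(\<Sum>n\<in>A. a n) \<le> (\<Sum>n<card A. a n)"
  using assms(2)
proof (induction A rule: finite_linorder_max_induct)
  case empty
  then show ?case by simp
next
  case (insert b A)
  have "card A \<le> b"
    using card_mono[of "{..<b}" A] insert by auto
  then have "a b \<le> a (card A)"
    using assms(1) by (simp add: decseq_def)
  moreover have "b \<notin> A" using insert by auto
  ultimately show ?case using insert by simp
qed

text \<open>Abel summation: the differences \<open>a (\<sigma> n) - a n\<close> have nonpositive
  partial sums, since \<open>\<sigma>\<close> maps \<open>{..<k}\<close> onto \<open>k\<close>
  distinct indices, and the weights \<open>u\<close> are nonnegative and nonincreasing.\<close>

lemma rearrangement_inequality: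
  fixes a u :: "nat \<Rightarrow> real"
  assumes "decseq a" "decseq u" "\<And>n. 0 \<le> u n" "inj \<sigma>"
  shows "(\<Sum>n<k. a (\<sigma> n) * u n) \<le> (\<Sum>n<k. a n * u n)"
proof -
  define g where "g n = a (\<sigma> n) - a n" for n
  have g: "(\<Sum>n<k. g n) \<le> 0" for k
  proof -
    have inj: "inj_on \<sigma> {..<k}" using assms(4) by (rule inj_on_subset) simp
    have "(\<Sum>n<k. a (\<sigma> n)) = (\<Sum>n\<in>\<sigma> ` {..<k}. a n)"
      using inj by (simp add: sum.reindex)
    also have "\<dots> \<le> (\<Sum>n<k. a n)"
      using sum_decseq_le[OF assms(1), of "\<sigma> ` {..<k}"] inj by (simp add: card_image)
    finally show ?thesis by (simp add: g_def sum_subtractf)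
  qed
  \<comment> \<open>The factor \<open>u k\<close> on the right makes Abel summation an induction:
    the partial sum is nonpositive, so replacing \<open>u k\<close> by the smaller
    \<open>u (Suc k)\<close> only increases the product.\<close>
  have "(\<Sum>n<k. g n * u n) \<le> u k * (\<Sum>n<k. g n)"
  proof (induction k)
    case (Suc k)
    then have "(\<Sum>n<Suc k. g n * u n) \<le> u k * (\<Sum>n<Suc k. g n)"
      by (simp add: algebra_simps)
    also have "\<dots> \<le> u (Suc k) * (\<Sum>n<Suc k. g n)"
      using assms(2) by (intro mult_right_mono_neg g) (simp add: decseq_Suc_iff)
    finally show ?case .
  qed simp
  also have "\<dots> \<le> 0"
    using assms(3) g by (simp add: mult_nonneg_nonpos)
  finally show ?thesis
    by (simp add: g_def algebra_simps sum_subtractf)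
qed

section \<open>Finitely supported sequences and their rearrangements\<close>

lemma c00I: "finite A \<Longrightarrow> (\<And>n. n \<notin> A \<Longrightarrow> x n = 0) \<Longrightarrow> x \<in> c00"
  unfolding c00_def by (auto intro: finite_subset[of _ A])

lemma c00_dominated:
  assumes "x \<in> c00" "\<And>n. x n = 0 \<Longrightarrow> y n = 0"
  shows "y \<in> c00"
  by (rule c00I[of "{n. x n \<noteq> 0}"]) (use assms in \<open>auto simp: c00_def\<close>)

lemma c00_permute:
  assumes "x \<in> c00" "bij \<pi>"
  shows "(\<lambda>n. x (\<pi> n)) \<in> c00"
  using finite_vimageI[of "{n. x n \<noteq> 0}" \<pi>] assms by (simp add: c00_def vimage_def bij_is_inj)

lemma decreasing_rearrangement:
  assumes "x \<in> c00"
  obtains \<pi> where "bij \<pi>" "decreasing_rearrangement x = (\<lambda>n. cmod (x (\<pi> n)))"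
    and "decseq (decreasing_rearrangement x)"
  using theI'[OF decreasing_rearrangement_ex1[OF assms]]
  unfolding decreasing_rearrangement_def by blast

lemma decreasing_rearrangement_eqI:
  assumes "x \<in> c00" "decseq (\<lambda>n. cmod (x n))"
  shows "decreasing_rearrangement x = (\<lambda>n. cmod (x n))"
  unfolding decreasing_rearrangement_def
  by (rule the1_equality[OF decreasing_rearrangement_ex1[OF assms(1)]])
    (use assms(2) in \<open>auto intro: exI[of _ id]\<close>)

lemma decreasing_rearrangement_props:
  assumes "x \<in> c00"
  shows "decseq (decreasing_rearrangement x)"
    and "0 \<le> decreasing_rearrangement x n"
    and "finite {n. decreasing_rearrangement x n \<noteq> 0}"
    and "(\<lambda>n. complex_of_real (decreasing_rearrangement x n)) \<in> c00"
proof -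
  obtain \<pi> where \<pi>: "bij \<pi>" "decreasing_rearrangement x = (\<lambda>n. cmod (x (\<pi> n)))"
    and d: "decseq (decreasing_rearrangement x)"
    using decreasing_rearrangement[OF assms] by blast
  show "decseq (decreasing_rearrangement x)" by (fact d)
  show "0 \<le> decreasing_rearrangement x n" by (simp add: \<pi>(2))
  show fin: "finite {n. decreasing_rearrangement x n \<noteq> 0}"
    using c00_permute[OF assms \<pi>(1)] by (simp add: \<pi>(2) c00_def)
  then show "(\<lambda>n. complex_of_real (decreasing_rearrangement x n)) \<in> c00"
    by (simp add: c00_def)
qed

lemma suminf_permute_finite:
  fixes g :: "nat \<Rightarrow> real"
  assumes "bij \<pi>" "finite {n. g n \<noteq> 0}"
  shows "(\<Sum>n. g (\<pi> n)) = (\<Sum>n. g n)"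
proof -
  let ?S = "{n. g n \<noteq> 0}"
  have "finite (\<pi> -` ?S)" by (rule finite_vimageI[OF assms(2) bij_is_inj[OF assms(1)]])
  then have "(\<Sum>n. g (\<pi> n)) = (\<Sum>n\<in>\<pi> -` ?S. g (\<pi> n))"
    by (intro suminf_finite) auto
  also have "\<dots> = (\<Sum>n\<in>?S. g n)"
    by (rule sum.reindex_bij_betw)
      (use assms(1) in \<open>auto simp: bij_betw_def inj_on_def surj_image_vimage_eq\<close>)
  also have "\<dots> = (\<Sum>n. g n)"
    using assms(2) by (intro suminf_finite[symmetric]) auto
  finally show ?thesis .
qed

section \<open>Symmetric gauge norms and norming coefficients\<close>

context
  fixes N :: "(nat \<Rightarrow> complex) \<Rightarrow> real"
  assumes N: "symmetric_gauge_norm N"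
begin

lemma gauge_scale: "x \<in> c00 \<Longrightarrow> N (\<lambda>n. c * x n) = cmod c * N x"
  and gauge_add: "x \<in> c00 \<Longrightarrow> y \<in> c00 \<Longrightarrow> N (\<lambda>n. x n + y n) \<le> N x + N y"
  and gauge_cmod: "x \<in> c00 \<Longrightarrow> N (\<lambda>n. complex_of_real (cmod (x n))) = N x"
  and gauge_permute: "x \<in> c00 \<Longrightarrow> bij \<pi> \<Longrightarrow> N (\<lambda>n. x (\<pi> n)) = N x"
  using N unfolding symmetric_gauge_norm_def norm_on_c00_def by metis+

lemma gauge_decreasing_rearrangement:
  assumes "x \<in> c00"
  shows "N (\<lambda>n. complex_of_real (decreasing_rearrangement x n)) = N x"
proof -
  obtain \<pi> where \<pi>: "bij \<pi>" "decreasing_rearrangement x = (\<lambda>n. cmod (x (\<pi> n)))"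
    using decreasing_rearrangement[OF assms] by blast
  then show ?thesis
    using gauge_cmod[OF c00_permute[OF assms \<pi>(1)]] gauge_permute[OF assms \<pi>(1)] by simp
qed

text \<open>Entries may be deleted or change phase. This serves to bound sign-twisted truncated test
  vectors and to isolate the leading entry of a rearrangement.\<close>

lemma gauge_truncate_le:
  assumes x: "x \<in> c00" and yx: "\<And>n. y n = 0 \<or> cmod (y n) = cmod (x n)"
  shows "N y \<le> N x"
proof -
  define X where "X n = complex_of_real (cmod (x n))" for n
  define Z where "Z n = (if y n = 0 then - X n else X n)" for n
  have X: "X \<in> c00" and Z: "Z \<in> c00"
    by (rule c00_dominated[OF x]; simp add: X_def Z_def)+
  have y: "y \<in> c00"
    by (rule c00_dominated[OF x]) (use yx in force)
  have NX: "N X = N x"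
    using gauge_cmod[OF x] by (simp add: X_def[abs_def])
  have "(\<lambda>n. complex_of_real (cmod (Z n))) = X"
    by (auto simp: Z_def X_def)
  then have NZ: "N Z = N x"
    using gauge_cmod[OF Z] NX by simp
  have XZ: "(\<lambda>n. X n + Z n) \<in> c00"
    by (rule c00_dominated[OF x]) (simp add: X_def Z_def)
  \<comment> \<open>\<open>\<bar>y\<bar>\<close> is the midpoint of \<open>\<bar>x\<bar>\<close> and a sign change of \<open>\<bar>x\<bar>\<close>.\<close>
  have "(\<lambda>n. complex_of_real (cmod (y n))) = (\<lambda>n. (1 / 2) * (X n + Z n))"
    using yx by (auto simp: X_def Z_def fun_eq_iff)
  then have "N y = (1 / 2) * N (\<lambda>n. X n + Z n)"
    using gauge_cmod[OF y] gauge_scale[OF XZ, of "1 / 2"] by simp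
  also have "\<dots> \<le> (1 / 2) * (N X + N Z)"
    using gauge_add[OF X Z] by simp
  finally show ?thesis using NX NZ by simp
qed

text \<open>Truncation to \<open>I\<close> puts every real sequence into \<open>c00\<close>, where
  \<open>N\<close> is governed by the norm axioms, so the real Hahn-Banach argument applies.\<close>

lemma sublinear_gauge:
  assumes "finite I"
  shows "sublinear (\<lambda>c. N (\<lambda>n. if n \<in> I then complex_of_real (c n) else 0))"
  unfolding sublinear_def
proof (intro conjI allI impI)
  have c: "(\<lambda>n. if n \<in> I then complex_of_real (c n) else 0) \<in> c00" for c
    by (rule c00I[OF assms]) simp
  show "N (\<lambda>n. if n \<in> I then complex_of_real (x n + y n) else 0)
      \<le> N (\<lambda>n. if n \<in> I then complex_of_real (x n) else 0)
        + N (\<lambda>n. if n \<in> I then complex_of_real (y n) else 0)" for x y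
  proof -
    have "(\<lambda>n. if n \<in> I then complex_of_real (x n + y n) else 0)
        = (\<lambda>n. (if n \<in> I then complex_of_real (x n) else 0)
          + (if n \<in> I then complex_of_real (y n) else 0))"
      by auto
    then show ?thesis using gauge_add[OF c c, of x y] by simp
  qed
  show "N (\<lambda>n. if n \<in> I then complex_of_real (t * x n) else 0)
      \<le> t * N (\<lambda>n. if n \<in> I then complex_of_real (x n) else 0)" if "0 \<le> t" for t x
  proof -
    have "(\<lambda>n. if n \<in> I then complex_of_real (t * x n) else 0)
        = (\<lambda>n. complex_of_real t * (if n \<in> I then complex_of_real (x n) else 0))"
      by auto
    then show ?thesis using gauge_scale[OF c, of "complex_of_real t" x] that by simp
  qed
qed

text \<open>The coefficients found here lie in the polar and norm \<open>x\<close>; the bound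
  \<open>a 0 \<le> 1\<close> follows later from normalization.\<close>

lemma norming_gauge_coeffs:
  assumes x: "x \<in> c00"
  shows "\<exists>a. decseq a \<and> (\<forall>n. 0 \<le> a n) \<and> finite {n. a n \<noteq> 0} \<and>
    (\<forall>y\<in>c00. (\<Sum>n. a n * decreasing_rearrangement y n) \<le> N y) \<and>
    N x \<le> (\<Sum>n. a n * decreasing_rearrangement x n)"
proof -
  define u where "u = decreasing_rearrangement x"
  note u = decreasing_rearrangement_props[OF x, folded u_def]
  obtain k where k: "{n. u n \<noteq> 0} \<subseteq> {..<k}"
    using finite_nat_iff_bounded u(3) by blast
  then have uk: "u n = 0" if "n \<notin> {..<k}" for n using that by auto
  define p where "p c = N (\<lambda>n. if n \<in> {..<k} then complex_of_real (c n) else 0)" for c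
  have p: "sublinear p"
    unfolding p_def by (rule sublinear_gauge) simp
  obtain f where f: "(\<forall>n. n \<notin> {..<k} \<longrightarrow> f n = 0) \<and>
    (\<forall>y. (\<forall>n. n \<notin> {..<k} \<longrightarrow> y n = 0) \<longrightarrow> (\<Sum>n<k. f n * y n) \<le> p y) \<and>
    p u \<le> (\<Sum>n<k. f n * u n)"
    using finite_dim_Hahn_Banach[OF p finite_lessThan uk] ..
  then have f0: "\<And>n. n \<notin> {..<k} \<Longrightarrow> f n = 0" by simp
  have fp: "(\<Sum>n<k. f n * y n) \<le> p y" if "\<And>n. n \<notin> {..<k} \<Longrightarrow> y n = 0" for y
    using f that by simp
  have fu: "p u \<le> (\<Sum>n<k. f n * u n)" using f by simp
  have F: "(\<lambda>n. complex_of_real (f n)) \<in> c00"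
    by (rule c00I[of "{..<k}"]) (use f0 in auto)
  define a where "a = decreasing_rearrangement (\<lambda>n. complex_of_real (f n))"
  note a = decreasing_rearrangement_props[OF F, folded a_def]
  obtain \<pi> where \<pi>: "bij \<pi>" "a = (\<lambda>n. \<bar>f (\<pi> n)\<bar>)"
    using decreasing_rearrangement[OF F] by (auto simp: a_def)
  define \<sigma> where "\<sigma> = inv \<pi>"
  have \<sigma>: "bij \<sigma>" "\<And>n. \<sigma> (\<pi> n) = n" "\<And>n. \<pi> (\<sigma> n) = n"
    using \<pi>(1) by (simp_all add: \<sigma>_def bij_imp_bij_inv bij_is_inj bij_is_surj surj_f_inv_f)
  show ?thesis
  proof (intro exI[of _ a] conjI allI ballI)
    fix y assume y: "y \<in> c00"
    define w where "w = decreasing_rearrangement y"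
    note w = decreasing_rearrangement_props[OF y, folded w_def]
    \<comment> \<open>The signs in \<open>?z\<close> turn \<open>f n\<close> into its absolute
      value, and \<open>\<sigma>\<close>, inverse to \<open>\<pi>\<close>, places the entries of
      \<open>w\<close> so that they meet the same coefficients as in the sum of
      \<open>a n * w n\<close>.\<close>
    let ?z = "\<lambda>n. if n \<in> {..<k} then complex_of_real (sgn (f n) * w (\<sigma> n)) else 0"
    have "(\<Sum>n. a n * w n) = (\<Sum>n. \<bar>f (\<pi> n)\<bar> * w (\<sigma> (\<pi> n)))"
      by (simp add: \<pi>(2) \<sigma>(2))
    also have "\<dots> = (\<Sum>n. \<bar>f n\<bar> * w (\<sigma> n))"
    proof (rule suminf_permute_finite[OF \<pi>(1)])
      show "finite {n. \<bar>f n\<bar> * w (\<sigma> n) \<noteq> 0}"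
        by (rule finite_subset[of _ "{..<k}"]) (use f0 in auto)
    qed
    also have "\<dots> = (\<Sum>n<k. \<bar>f n\<bar> * w (\<sigma> n))"
      by (rule suminf_finite) (use f0 in auto)
    also have "\<dots> = (\<Sum>n<k. f n * (if n \<in> {..<k} then sgn (f n) * w (\<sigma> n) else 0))"
      by (rule sum.cong) (auto simp: abs_sgn)
    also have "\<dots> \<le> N ?z"
      using fp[of "\<lambda>n. if n \<in> {..<k} then sgn (f n) * w (\<sigma> n) else 0"] by (simp add: p_def cong: if_cong)
    \<comment> \<open>Each entry of \<open>?z\<close> has modulus \<open>w (\<sigma> n)\<close>, or
      is zero because \<open>n \<ge> k\<close> or \<open>f n = 0\<close>.\<close>
    also have "\<dots> \<le> N (\<lambda>n. complex_of_real (w (\<sigma> n)))"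
      by (rule gauge_truncate_le[OF c00_permute[OF w(4) \<sigma>(1)]])
        (auto simp: norm_mult sgn_if)
    also have "\<dots> = N y"
      using gauge_permute[OF w(4) \<sigma>(1)] gauge_decreasing_rearrangement[OF y] by (simp add: w_def)
    finally show "(\<Sum>n. a n * decreasing_rearrangement y n) \<le> N y"
      by (simp add: w_def)
  next
    have "(\<lambda>n. if n \<in> {..<k} then complex_of_real (u n) else 0) = (\<lambda>n. complex_of_real (u n))"
      using uk by auto
    then have "N x \<le> (\<Sum>n<k. f n * u n)"
      using fu[unfolded p_def] gauge_decreasing_rearrangement[OF x] by (simp add: u_def)
    \<comment> \<open>Here \<open>a (\<sigma> n)\<close> is the absolute value of
      \<open>f n\<close>, and \<open>u n\<close> is nonnegative. The rearrangement inequality then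
      removes \<open>\<sigma>\<close>.\<close>
    also have "\<dots> \<le> (\<Sum>n<k. a (\<sigma> n) * u n)"
      by (rule sum_mono) (auto simp: \<pi>(2) \<sigma>(3) intro!: mult_right_mono u(2))
    also have "\<dots> \<le> (\<Sum>n<k. a n * u n)"
      using rearrangement_inequality[OF a(1) u(1,2) bij_is_inj[OF \<sigma>(1)]] .
    also have "\<dots> = (\<Sum>n. a n * u n)"
      by (rule suminf_finite[symmetric]) (use uk in auto)
    finally show "N x \<le> (\<Sum>n. a n * decreasing_rearrangement x n)"
      by (simp add: u_def)
  qed (fact a)+
qed

end

section \<open>The supremum formula over the polar\<close>

theorem corollary7p4:
  fixes N :: "(nat \<Rightarrow> complex) \<Rightarrow> real"
  assumes "symmetric_gauge_norm N"
    and "normalized_norm N"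
  shows "\<exists>G' \<subseteq> gauge_coeffs. (\<lambda>n. if n = 0 then 1 else 0) \<in> G' \<and>
    (\<forall>x\<in>c00. N x = Sup {(\<Sum>n. a n * decreasing_rearrangement x n) | a. a \<in> G'})"
proof -
  note N = assms(1)
  define P where "P a \<longleftrightarrow> (\<forall>x\<in>c00. (\<Sum>n. a n * decreasing_rearrangement x n) \<le> N x)"
    for a :: "nat \<Rightarrow> real"
  define G' where "G' = {a \<in> gauge_coeffs. P a}"
  let ?e = "\<lambda>n::nat. if n = 0 then 1 else 0 :: real"
  let ?E = "\<lambda>n::nat. if n = 0 then 1 else 0 :: complex"
  have E: "?E \<in> c00" by (rule c00I[of "{0}"]) auto
  have NE: "N ?E = 1" using assms(2) by (simp add: normalized_norm_def)
  have sum0: "(\<Sum>n. g n) = g 0" if "\<And>n. n \<noteq> 0 \<Longrightarrow> g n = 0" for g :: "nat \<Rightarrow> real"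
    using suminf_finite[of "{0}" g] that by simp
  have "?e \<in> gauge_coeffs"
    by (auto simp: gauge_coeffs_def decseq_def)
  moreover have "P ?e"
    unfolding P_def
  proof
    fix x assume x: "x \<in> c00"
    define u where "u = decreasing_rearrangement x"
    note u = decreasing_rearrangement_props[OF x, folded u_def]
    \<comment> \<open>Pairing with \<open>?e\<close> picks out \<open>u 0\<close>, which is the norm
      of \<open>u\<close> with all later entries deleted.\<close>
    have "(\<Sum>n. ?e n * u n) = u 0" by (subst sum0) auto
    also have "\<dots> = N (\<lambda>n. complex_of_real (u 0) * ?E n)"
      using gauge_scale[OF N E, of "complex_of_real (u 0)"] NE u(2)[of 0] by simp
    also have "\<dots> \<le> N (\<lambda>n. complex_of_real (u n))"
      by (rule gauge_truncate_le[OF N u(4)]) auto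
    also have "\<dots> = N x"
      using gauge_decreasing_rearrangement[OF N x] by (simp add: u_def)
    finally show "(\<Sum>n. ?e n * decreasing_rearrangement x n) \<le> N x"
      by (simp only: u_def)
  qed
  ultimately have "?e \<in> G'" by (simp add: G'_def)
  moreover have "N x = Sup {(\<Sum>n. a n * decreasing_rearrangement x n) | a. a \<in> G'}"
    if x: "x \<in> c00" for x
  proof -
    obtain a where a: "decseq a" "\<And>n. 0 \<le> a n" "finite {n. a n \<noteq> 0}"
      and P: "P a" and norming: "N x \<le> (\<Sum>n. a n * decreasing_rearrangement x n)"
      using norming_gauge_coeffs[OF N x, folded P_def] by blast
    \<comment> \<open>Testing the polar inequality at \<open>?E\<close>, which is its own
      rearrangement, gives \<open>a 0 \<le> N ?E = 1\<close>, the condition still missing for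
      \<open>gauge_coeffs\<close>.\<close>
    have "decreasing_rearrangement ?E = (\<lambda>n. cmod (?E n))"
      by (rule decreasing_rearrangement_eqI[OF E]) (auto simp: decseq_def)
    then have "a 0 = (\<Sum>n. a n * decreasing_rearrangement ?E n)"
      by (subst sum0) auto
    also have "\<dots> \<le> 1"
      using P E NE by (auto simp: P_def)
    finally have "a \<in> G'"
      using a P by (simp add: G'_def gauge_coeffs_def)
    moreover have "N x = (\<Sum>n. a n * decreasing_rearrangement x n)"
      using norming P x by (intro antisym) (auto simp: P_def)
    ultimately have "N x \<in> {(\<Sum>n. a n * decreasing_rearrangement x n) | a. a \<in> G'}"
      by blast
    moreover have "s \<le> N x"
      if "s \<in> {(\<Sum>n. a n * decreasing_rearrangement x n) | a. a \<in> G'}" for s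
      using that x by (auto simp: G'_def P_def)
    ultimately show ?thesis
      \<comment> \<open>The value \<open>N x\<close> belongs to the set and bounds it above, so the
        supremum is a maximum.\<close>
      by (rule cSup_eq_maximum[symmetric])
  qed
  ultimately show ?thesis
    by (intro exI[of _ G']) (auto simp: G'_def)
qed

end
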